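(* Let $Z$ be an ideal tile for a self-affine $\mathbb{Z}^n$-tile $T=T(A,\mathcal{D})$ and let $u\in\operatorname{int}(Z)$. Then there is a homeomorphism $F:\mathbb{R}^n\to\mathbb{R}^n$ such that $(Z-u,F)$ is a monotone model for $T$.
   Context: Self-affine tiles: let $A$ be an expanding $n\times n$ integer matrix (every eigenvalue has modulus $>1$) and let $\mathcal{D}\subset\mathbb{Z}^n$ be a complete set of residue class representatives of $\mathbb{Z}^n/A\mathbb{Z}^n$ with $0\in\mathcal{D}$. The self-affine tile $T=T(A,\mathcal{D})$ is the unique nonempty compact set $T\subset\mathbb{R}^n$ with $AT=T+\mathcal{D}$. It is a self-affine $\mathbb{Z}^n$-tile if the translates $T+z$, $z\in\mathbb{Z}^n$, cover $\mathbb{R}^n$ with pairwise disjoint interiors. $\mathbb{Z}^n$-tiles: a $\mathbb{Z}^n$-tile is a compact set $M\subset\mathbb{R}^n$ that is the closure of its interior, with $\partial M$ of Lebesgue measure $0$, whose $\mathbb{Z}^n$-translates cover $\mathbb{R}^n$ with disjoint interiors (every self-affine $\mathbb{Z}^n$-tile is one). For $S\subset\mathbb{Z}^n$ put $\langle S\rangle_M=\bigcap_{s\in S}(M+s)$; for a collection $\mathcal{C}$ of subsets of $\mathbb{Z}^n$ put $\langle\mathcal{C}\rangle_M=\bigcup_{S\in\mathcal{C}}\langle S\rangle_M$. Let $\mathcal{K}(M)=\{S\subset\mathbb{Z}^n : S\ne\emptyset,\ \langle S\rangle_M\neq\emptyset\}$. For $S\in\mathcal{K}(M)$ put $\delta S=\{S\cup\{x\}: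 x\in\mathbb{Z}^n\setminus S\}\cap\mathcal{K}(M)$, and for a collection $\mathcal{C}\subset\mathcal{K}(M)$ of sets of the same cardinality put $\delta\mathcal{C}=\{S\cup\{x\}: S\in\mathcal{C},\ x\in\mathbb{Z}^n\setminus\bigcup_{S'\in\mathcal{C}}S'\}\cap\mathcal{K}(M)$. Subdivision operator: for $S\in\mathcal{K}(T)$, $P(S)=\{(p+A)(S)\in\mathcal{K}(T): p\in\mathcal{D}^S\}$, where $\mathcal{D}^S$ is the set of functions $p:S\to\mathcal{D}$ and $(p+A)(S)=\{p(s)+As: s\in S\}$. Ideal tile: a $\mathbb{Z}^n$-tile $Z$ with connected interior is an ideal tile for $T$ if (i) $\mathcal{K}(Z)=\mathcal{K}(T)$; (ii) for each $S\in\mathcal{K}(Z)$ the set $\langle S\rangle_Z$ is connected and homeomorphic to $\langle P(S)\rangle_Z$; (iii) for each $S\in\mathcal{K}(Z)$ each homeomorphism from $\langle\delta S\rangle_Z$ to $\langle\delta P(S)\rangle_Z$ extends to a homeomorphism from $\langle S\rangle_Z$ to $\langle P(S)\rangle_Z$. Models: a map $f:\mathbb{R}^n\to\mathbb{R}^n$ is $\mathbb{Z}^n$-equivariant if $f(x+z)=f(x)+z$ for all $x\in\mathbb{R}^n,z\in\mathbb{Z}^n$. A model $(M,F)$ for $T$ is a $\mathbb{Z}^n$-tile $M$ with a homeomorphism $F:\mathbb{R}^n\to\mathbb{R}^n$ such that $FM=M+\mathcal{D}$, $A^{-1}F$ is $\mathbb{Z}^n$-equivariant, and $F(0)=0$.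 It is a monotone model if $\mathcal{K}(M)=\mathcal{K}(T)$ and $\langle S\rangle_M$ is connected for each $S\subset\mathbb{Z}^n$ (the empty set counts as connected). *)

theory Defs
  imports "HOL-Analysis.Analysis"
begin

definition int_lattice :: "(real ^ 'n) set" where
  "int_lattice = {z. \<forall>i. z $ i \<in> \<int>}"

definition integer_matrix :: "real ^ 'n ^ 'n \<Rightarrow> bool" where
  "integer_matrix A \<longleftrightarrow> (\<forall>i j. A $ i $ j \<in> \<int>)"

text \<open>Eigenvalues of a real matrix are taken in the complex numbers.\<close>

definition complex_eigenvalue :: "real ^ 'n ^ 'n \<Rightarrow> complex \<Rightarrow> bool" where
  "complex_eigenvalue A c \<longleftrightarrow>
     (\<exists>v :: complex ^ 'n. v \<noteq> 0 \<and> (\<chi> i j. complex_of_real (A $ i $ j)) *v v = c *s v)"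

definition expanding :: "real ^ 'n ^ 'n \<Rightarrow> bool" where
  "expanding A \<longleftrightarrow> (\<forall>c. complex_eigenvalue A c \<longrightarrow> cmod c > 1)"

definition residue_representatives :: "real ^ 'n ^ 'n \<Rightarrow> (real ^ 'n) set \<Rightarrow> bool" where
  "residue_representatives A D \<longleftrightarrow>
     D \<subseteq> int_lattice \<and>
     (\<forall>z\<in>int_lattice. \<exists>!d. d \<in> D \<and> z - d \<in> (\<lambda>w. A *v w) ` int_lattice)"

definition translates_tile :: "(real ^ 'n) set \<Rightarrow> bool" where
  "translates_tile M \<longleftrightarrow>
     (\<Union>z\<in>int_lattice. (\<lambda>x. x + z) ` M) = UNIV \<and>
     (\<forall>z\<in>int_lattice. \<forall>w\<in>int_lattice. z \<noteq> w \<longrightarrow>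
        interior ((\<lambda>x. x + z) ` M) \<inter> interior ((\<lambda>x. x + w) ` M) = {})"

text \<open>For an expanding \<open>A\<close> and a finite digit set \<open>D\<close>, exactly one nonempty compact set \<open>T\<close>
  satisfies \<open>A T = T + D\<close>; hence the tile is given by its characterising property rather than
  as a function of \<open>A\<close> and \<open>D\<close>.\<close>

definition self_affine_tile :: "real ^ 'n ^ 'n \<Rightarrow> (real ^ 'n) set \<Rightarrow> (real ^ 'n) set \<Rightarrow> bool" where
  "self_affine_tile A D T \<longleftrightarrow>
     integer_matrix A \<and> expanding A \<and> residue_representatives A D \<and> 0 \<in> D \<and>
     T \<noteq> {} \<and> compact T \<and> (\<lambda>x. A *v x) ` T = T + D"

definition self_affine_Zn_tile :: "real ^ 'n ^ 'n \<Rightarrow> (real ^ 'n) set \<Rightarrow> (real ^ 'n) set \<Rightarrow> bool" where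
  "self_affine_Zn_tile A D T \<longleftrightarrow> self_affine_tile A D T \<and> translates_tile T"

definition Zn_tile :: "(real ^ 'n) set \<Rightarrow> bool" where
  "Zn_tile M \<longleftrightarrow>
     compact M \<and> closure (interior M) = M \<and> frontier M \<in> null_sets lebesgue \<and> translates_tile M"

text \<open>\<open>cell M {} = UNIV\<close>, the usual convention for an empty intersection.\<close>

definition cell :: "(real ^ 'n) set \<Rightarrow> (real ^ 'n) set \<Rightarrow> (real ^ 'n) set" where
  "cell M S = (\<Inter>s\<in>S. (\<lambda>x. x + s) ` M)"

definition cells :: "(real ^ 'n) set \<Rightarrow> (real ^ 'n) set set \<Rightarrow> (real ^ 'n) set" where
  "cells M C = (\<Union>S\<in>C. cell M S)"

definition tile_complex :: "(real ^ 'n) set \<Rightarrow> (real ^ 'n) set set" where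
  "tile_complex M = {S. S \<subseteq> int_lattice \<and> S \<noteq> {} \<and> cell M S \<noteq> {}}"

definition delta :: "(real ^ 'n) set \<Rightarrow> (real ^ 'n) set \<Rightarrow> (real ^ 'n) set set" where
  "delta M S = {S \<union> {x} | x. x \<in> int_lattice - S} \<inter> tile_complex M"

definition delta_coll :: "(real ^ 'n) set \<Rightarrow> (real ^ 'n) set set \<Rightarrow> (real ^ 'n) set set" where
  "delta_coll M C = {S \<union> {x} | S x. S \<in> C \<and> x \<in> int_lattice - \<Union>C} \<inter> tile_complex M"

definition subdiv ::
    "real ^ 'n ^ 'n \<Rightarrow> (real ^ 'n) set \<Rightarrow> (real ^ 'n) set \<Rightarrow> (real ^ 'n) set \<Rightarrow> (real ^ 'n) set set" where
  "subdiv A D T S = {(\<lambda>s. p s + A *v s) ` S | p. p \<in> S \<rightarrow> D} \<inter> tile_complex T"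

text \<open>Below, \<open>subdiv\<close> is always formed with respect to \<open>T\<close>, whereas \<open>delta\<close> and
  \<open>delta_coll\<close> are formed with respect to \<open>Z\<close>; since \<open>tile_complex Z = tile_complex T\<close>
  is the first requirement, this choice makes no difference.\<close>

definition ideal_tile ::
    "real ^ 'n ^ 'n \<Rightarrow> (real ^ 'n) set \<Rightarrow> (real ^ 'n) set \<Rightarrow> (real ^ 'n) set \<Rightarrow> bool" where
  "ideal_tile A D T Z \<longleftrightarrow>
     Zn_tile Z \<and> connected (interior Z) \<and>
     tile_complex Z = tile_complex T \<and>
     (\<forall>S\<in>tile_complex Z.
        connected (cell Z S) \<and> cell Z S homeomorphic cells Z (subdiv A D T S)) \<and>
     (\<forall>S\<in>tile_complex Z. \<forall>h h'.
        homeomorphism (cells Z (delta Z S)) (cells Z (delta_coll Z (subdiv A D T S))) h h' \<longrightarrow>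
        (\<exists>g g'. homeomorphism (cell Z S) (cells Z (subdiv A D T S)) g g' \<and>
                (\<forall>x\<in>cells Z (delta Z S). g x = h x)))"

definition Zn_equivariant :: "(real ^ 'n \<Rightarrow> real ^ 'n) \<Rightarrow> bool" where
  "Zn_equivariant f \<longleftrightarrow> (\<forall>x. \<forall>z\<in>int_lattice. f (x + z) = f x + z)"

definition model ::
    "real ^ 'n ^ 'n \<Rightarrow> (real ^ 'n) set \<Rightarrow> (real ^ 'n) set \<Rightarrow> (real ^ 'n \<Rightarrow> real ^ 'n) \<Rightarrow> bool" where
  "model A D M F \<longleftrightarrow>
     Zn_tile M \<and> (\<exists>G. homeomorphism UNIV UNIV F G) \<and>
     F ` M = M + D \<and> Zn_equivariant (\<lambda>x. matrix_inv A *v F x) \<and> F 0 = 0"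

definition monotone_model ::
    "real ^ 'n ^ 'n \<Rightarrow> (real ^ 'n) set \<Rightarrow> (real ^ 'n) set \<Rightarrow> (real ^ 'n) set \<Rightarrow>
     (real ^ 'n \<Rightarrow> real ^ 'n) \<Rightarrow> bool" where
  "monotone_model A D T M F \<longleftrightarrow>
     model A D M F \<and> tile_complex M = tile_complex T \<and>
     (\<forall>S. S \<subseteq> int_lattice \<longrightarrow> connected (cell M S))"

end

theory Submission
  imports Defs
begin

text \<open>
  Call \<open>{s. x \<in> Z + s}\<close> the address of \<open>x\<close>. The points whose address has at least \<open>k\<close> elements
  form the union of the cells \<open>cell Z S\<close> with \<open>card S \<ge> k\<close>; these unions are the skeleta of a
  decomposition of space, the cells with the largest index sets being the lowest-dimensional ones.
  The homeomorphism is built upwards along the skeleta, that is, by descending induction on \<open>k\<close>.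
  The induction starts because addresses have bounded cardinality.

  The target of \<open>cell Z S\<close> is \<open>cells Z (subdiv A D T S)\<close>. The two descriptions of \<open>tile_complex\<close>,
  by \<open>Z\<close> and by \<open>T\<close>, together show that this target is simply
  \<open>subcell A D Z S = (\<Inter>s\<in>S. Z + D + A s)\<close>, so that targets intersect exactly as the cells do:
  the target of \<open>S \<union> S'\<close> is the intersection of the targets of \<open>S\<close> and \<open>S'\<close>. Moreover a nonempty
  target forces \<open>S\<close> to be in the complex (\<open>subcell_imp_complex\<close>), because \<open>A T = T + D\<close>. Hence a
  map that is injective on every cell of a skeleton and sends it onto its target is injective on
  the whole skeleton (\<open>skeletal_map_inj\<close>).

  The boundary \<open>cells Z (delta Z S)\<close> of a cell lies in the skeleton below, and the map given there
  carries it homeomorphically onto the boundary of the target, since the boundary of the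
  subdivision is the subdivision of the boundary (\<open>cells_delta_subdiv\<close>; here the uniqueness of
  residues enters). The extension property of the ideal tile then fills in the cell
  (\<open>skeletal_map_extend_cell\<close>). Doing so for one cell in each lattice orbit and transporting
  along translations keeps the map equivariant (\<open>skeletal_map_descend\<close>); no conflict arises because
  a finite nonempty set is not invariant under a nonzero translation. At \<open>k = 1\<close> the skeleton is
  the whole space and the result is a continuous bijection \<open>F\<close> with \<open>F Z = Z + D\<close> and
  \<open>F (x + z) = F x + A z\<close>; by invariance of domain it is a homeomorphism.

  A model whose tile is \<open>Z - u\<close> must fix the origin, which after translation means \<open>F u = u\<close>. As \<open>F\<close>
  maps the interior of \<open>Z\<close> onto the interior of \<open>Z + D\<close>, which contains \<open>u\<close>, the preimage of \<open>u\<close>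
  lies in the interior of \<open>Z\<close>. This interior is connected, so a homeomorphism supported in it moves
  \<open>u\<close> to that preimage; its periodic extension (\<open>periodize\<close>), followed by \<open>F\<close>, fixes \<open>u\<close>.
\<close>

section \<open>The integer lattice\<close>

lemma zero_in_int_lattice [simp]: "0 \<in> int_lattice"
  by (simp add: int_lattice_def)

lemma int_lattice_add: "z \<in> int_lattice \<Longrightarrow> w \<in> int_lattice \<Longrightarrow> z + w \<in> int_lattice"
  by (simp add: int_lattice_def)

lemma int_lattice_diff: "z \<in> int_lattice \<Longrightarrow> w \<in> int_lattice \<Longrightarrow> z - w \<in> int_lattice"
  by (simp add: int_lattice_def)

lemma int_lattice_uminus: "z \<in> int_lattice \<Longrightarrow> - z \<in> int_lattice"
  by (simp add: int_lattice_def)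

lemma int_lattice_integer_matrix:
  "integer_matrix A \<Longrightarrow> z \<in> int_lattice \<Longrightarrow> A *v z \<in> int_lattice"
  by (auto simp: int_lattice_def integer_matrix_def matrix_vector_mult_def intro!: Ints_sum Ints_mult)

lemma finite_int_lattice_bounded:
  fixes B :: "(real ^ 'n) set"
  assumes "bounded B"
  shows "finite (int_lattice \<inter> B)"
proof -
  obtain r where r: "\<And>x. x \<in> B \<Longrightarrow> norm x \<le> r"
    using assms bounded_iff by blast
  define m where "m = \<lceil>r\<rceil>"
  have "int_lattice \<inter> B \<subseteq> (\<lambda>f. \<chi> i. of_int (f i)) ` (PiE UNIV (\<lambda>_::'n. {-m..m}))"
  proof
    fix z :: "real ^ 'n" assume z: "z \<in> int_lattice \<inter> B"
    have zi: "of_int \<lfloor>z $ i\<rfloor> = z $ i" for i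
      using z by (auto simp: int_lattice_def elim!: Ints_cases)
    have "\<lfloor>z $ i\<rfloor> \<in> {-m..m}" for i
    proof -
      have "\<bar>z $ i\<bar> \<le> r" using r z component_le_norm_cart order_trans by blast
      then have "\<bar>z $ i\<bar> \<le> of_int m" unfolding m_def by linarith
      then show ?thesis using zi[of i] by (simp add: abs_le_iff) linarith
    qed
    moreover have "z = (\<chi> i. of_int \<lfloor>z $ i\<rfloor>)" by (simp add: vec_eq_iff zi)
    ultimately show "z \<in> (\<lambda>f. \<chi> i. of_int (f i)) ` (PiE UNIV (\<lambda>_::'n. {-m..m}))"
      by (intro image_eqI[where x = "\<lambda>i. \<lfloor>z $ i\<rfloor>"]) auto
  qed
  then show ?thesis
    by (rule finite_subset) (auto intro!: finite_imageI finite_PiE)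
qed

text \<open>The sum of the elements of \<open>S\<close> changes by \<open>card S\<close> times the translation vector, so the action
  of translations on finite nonempty sets is free.\<close>

lemma finite_translate_eq_imp_eq:
  fixes S :: "(real ^ 'n) set"
  assumes "finite S" "S \<noteq> {}" "(+) e ` S = (+) e' ` S"
  shows "e = e'"
proof -
  have *: "\<Sum>((+) a ` S) = of_nat (card S) *\<^sub>R a + \<Sum>S" for a
    by (subst sum.reindex) (simp_all add: sum.distrib sum_constant_scaleR del: sum_constant)
  have "of_nat (card S) *\<^sub>R e = of_nat (card S) *\<^sub>R e'"
    using *[of e] *[of e'] assms(3) by auto
  then show ?thesis using assms(1,2) by simp
qed

text \<open>Choosing a representative of every translation orbit and recording the translation that leads
  from it to \<open>S\<close>, which is unique by freeness, yields a lattice point that moves along with \<open>S\<close>.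
  Translating by it reduces equivariant choices to arbitrary ones.\<close>

lemma exists_equivariant_anchor:
  "\<exists>c :: (real ^ 'n) set \<Rightarrow> real ^ 'n. \<forall>S. finite S \<longrightarrow> S \<noteq> {} \<longrightarrow>
     c S \<in> int_lattice \<and> (\<forall>z\<in>int_lattice. c ((+) z ` S) = c S + z)"
proof -
  define R :: "(real ^ 'n) set \<Rightarrow> (real ^ 'n) set"
    where "R S = (SOME R. \<exists>z\<in>int_lattice. R = (+) z ` S)" for S
  define e where "e S = (SOME z. z \<in> int_lattice \<and> R S = (+) z ` S)" for S
  have R: "\<exists>z\<in>int_lattice. R S = (+) z ` S" for S
    unfolding R_def by (rule someI_ex) (use zero_in_int_lattice in blast)
  have e: "e S \<in> int_lattice \<and> R S = (+) (e S) ` S" for S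
    unfolding e_def by (rule someI_ex) (use R in blast)
  have R_translate: "R ((+) w ` S) = R S" if w: "w \<in> int_lattice" for w S
  proof -
    have "(\<exists>z\<in>int_lattice. Q = (+) z ` ((+) w ` S)) \<longleftrightarrow> (\<exists>z\<in>int_lattice. Q = (+) z ` S)" for Q
    proof
      assume "\<exists>z\<in>int_lattice. Q = (+) z ` ((+) w ` S)"
      then obtain z where "z \<in> int_lattice" "Q = (+) (z + w) ` S"
        by (auto simp: image_image add.assoc)
      then show "\<exists>z\<in>int_lattice. Q = (+) z ` S" using w int_lattice_add by blast
    next
      assume "\<exists>z\<in>int_lattice. Q = (+) z ` S"
      then obtain z where "z \<in> int_lattice" "Q = (+) (z - w) ` ((+) w ` S)"
        by (auto simp: image_image algebra_simps)
      then show "\<exists>z\<in>int_lattice. Q = (+) z ` ((+) w ` S)" using w int_lattice_diff by blast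
    qed
    then show ?thesis unfolding R_def by simp
  qed
  have "e S = e ((+) w ` S) + w" if "w \<in> int_lattice" "finite S" "S \<noteq> {}" for w S
  proof (rule finite_translate_eq_imp_eq[OF that(2,3)])
    have "(+) (e S) ` S = (+) (e ((+) w ` S)) ` ((+) w ` S)"
      using e R_translate[OF that(1)] by metis
    then show "(+) (e S) ` S = (+) (e ((+) w ` S) + w) ` S"
      by (simp add: image_image add.assoc)
  qed
  then have "- e ((+) w ` S) = - e S + w" if "w \<in> int_lattice" "finite S" "S \<noteq> {}" for w S
    using that by fastforce
  moreover have "- e S \<in> int_lattice" for S using e int_lattice_uminus by blast
  ultimately show ?thesis by (intro exI[of _ "\<lambda>S. - e S"]) blast
qed

text \<open>A real kernel vector is a complex eigenvector for the eigenvalue \<open>0\<close>, whose modulus is not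
  greater than \<open>1\<close>.\<close>

lemma expanding_mult_eq_0:
  assumes "expanding A" "A *v x = 0"
  shows "x = 0"
proof (rule ccontr)
  assume "x \<noteq> 0"
  define v :: "complex ^ 'a" where "v = (\<chi> i. complex_of_real (x $ i))"
  have "v \<noteq> 0" using \<open>x \<noteq> 0\<close> by (auto simp: v_def vec_eq_iff)
  moreover have "(\<chi> i j. complex_of_real (A $ i $ j)) *v v = 0 *s v"
  proof -
    have "(\<Sum>j\<in>UNIV. complex_of_real (A $ i $ j) * complex_of_real (x $ j)) = 0" for i
    proof -
      have "(\<Sum>j\<in>UNIV. A $ i $ j * x $ j) = 0"
        using assms(2) by (simp add: matrix_vector_mult_def vec_eq_iff)
      then have "complex_of_real (\<Sum>j\<in>UNIV. A $ i $ j * x $ j) = 0" by simp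
      then show ?thesis by simp
    qed
    then show ?thesis by (simp add: v_def matrix_vector_mult_def vec_eq_iff)
  qed
  ultimately have "complex_eigenvalue A 0" unfolding complex_eigenvalue_def by blast
  then show False using assms(1) by (auto simp: expanding_def)
qed

section \<open>Cells of a tile\<close>

lemma mem_translate: "x \<in> (\<lambda>x. x + s) ` M \<longleftrightarrow> x - s \<in> M" for x s :: "'a::group_add"
proof
  assume "x - s \<in> M"
  then show "x \<in> (\<lambda>x. x + s) ` M" by (intro image_eqI[where x = "x - s"]) simp_all
qed auto

lemma mem_cell: "x \<in> cell M S \<longleftrightarrow> (\<forall>s\<in>S. x - s \<in> M)"
  by (simp add: cell_def mem_translate)

lemma cell_translate: "x + z \<in> cell M ((+) z ` S) \<longleftrightarrow> x \<in> cell M S"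
  by (simp add: mem_cell algebra_simps)

lemma mem_cells_delta:
  "x \<in> cells M (delta M S) \<longleftrightarrow> S \<subseteq> int_lattice \<and> (\<exists>z\<in>int_lattice - S. x \<in> cell M (insert z S))"
  by (auto simp: cells_def delta_def tile_complex_def)

text \<open>In terms of addresses, cells are the sets \<open>{x. S \<subseteq> address M x}\<close>. The points of \<open>cell M S\<close> with
  address exactly \<open>S\<close> form its open part, and the others its boundary \<open>cells M (delta M S)\<close>.\<close>

definition address :: "(real ^ 'n) set \<Rightarrow> real ^ 'n \<Rightarrow> (real ^ 'n) set" where
  "address M x = {s \<in> int_lattice. x - s \<in> M}"

lemma address_subset: "address M x \<subseteq> int_lattice"
  by (auto simp: address_def)

lemma mem_cell_iff_subset_address:
  "S \<subseteq> int_lattice \<Longrightarrow> x \<in> cell M S \<longleftrightarrow> S \<subseteq> address M x"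
  by (auto simp: mem_cell address_def)

lemma address_translate:
  assumes "z \<in> int_lattice"
  shows "address M (x + z) = (+) z ` address M x"
proof -
  have "s \<in> address M (x + z) \<longleftrightarrow> s - z \<in> address M x" for s
    using assms int_lattice_add[of "s - z" z] int_lattice_diff[of s z]
    by (auto simp: address_def algebra_simps)
  then show ?thesis
    using mem_translate[of _ z "address M x"] by (auto simp: add.commute)
qed

lemma finite_address:
  assumes "compact M"
  shows "finite (address M x)"
proof -
  have "address M x \<subseteq> int_lattice \<inter> (\<lambda>y. x - y) ` M"
    by (auto simp: address_def image_iff) (metis diff_diff_eq2 add_diff_cancel_left')
  moreover have "bounded ((\<lambda>y. x - y) ` M)"
    using assms by (intro compact_imp_bounded compact_continuous_image continuous_intros)
  ultimately show ?thesis
    using finite_int_lattice_bounded finite_subset by blast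
qed

text \<open>Relative to one of its elements, an address consists of lattice points in the bounded difference
  set \<open>M - M\<close>.\<close>

lemma card_address_bounded:
  fixes M :: "(real ^ 'n) set"
  assumes "compact M"
  shows "\<exists>N. \<forall>x. card (address M x) \<le> N"
proof -
  define B where "B = int_lattice \<inter> (\<lambda>p. fst p - snd p) ` (M \<times> M)"
  have "finite B" unfolding B_def
    using assms
    by (intro finite_int_lattice_bounded compact_imp_bounded compact_continuous_image
        continuous_intros compact_Times)
  have "card (address M x) \<le> card B" for x
  proof (cases "address M x = {}")
    case False
    then obtain s where s: "s \<in> address M x" by blast
    have "(\<lambda>t. t - s) ` address M x \<subseteq> B"
    proof
      fix w assume "w \<in> (\<lambda>t. t - s) ` address M x"
      then obtain t where t: "t \<in> address M x" "w = t - s" by blast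
      then have "w = (x - s) - (x - t)" "x - s \<in> M" "x - t \<in> M" "w \<in> int_lattice"
        using s int_lattice_diff by (auto simp: address_def)
      then show "w \<in> B" unfolding B_def by (auto intro!: image_eqI[where x = "(x - s, x - t)"])
    qed
    then have "card ((\<lambda>t. t - s) ` address M x) \<le> card B"
      using \<open>finite B\<close> card_mono by blast
    then show ?thesis by (simp add: card_image)
  qed auto
  then show ?thesis by blast
qed

lemma closed_cell: "compact M \<Longrightarrow> closed (cell M S)"
  unfolding cell_def by (intro closed_INT ballI compact_imp_closed compact_continuous_image continuous_intros)

lemma compact_cell:
  assumes "compact M" "S \<noteq> {}"
  shows "compact (cell M S)"
proof -
  obtain s where s: "s \<in> S" using assms by blast
  then have "cell M S \<subseteq> (\<lambda>x. x + s) ` M" by (auto simp: cell_def)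
  moreover have "compact ((\<lambda>x. x + s) ` M)"
    using assms by (intro compact_continuous_image continuous_intros)
  ultimately show ?thesis
    by (metis closed_cell[OF assms(1)] compact_Int_closed inf.absorb_iff2)
qed

lemma finite_delta:
  assumes "compact M" "S \<noteq> {}"
  shows "finite (delta M S)"
proof -
  obtain s where s: "s \<in> S" using assms by blast
  have "delta M S \<subseteq> (\<lambda>z. S \<union> {z}) ` (int_lattice \<inter> (\<lambda>p. fst p - snd p + s) ` (M \<times> M))"
  proof
    fix S' assume "S' \<in> delta M S"
    then obtain z x where z: "S' = S \<union> {z}" "z \<in> int_lattice" "x \<in> cell M S'"
      by (auto simp: delta_def tile_complex_def)
    then have "x - s \<in> M" "x - z \<in> M" "z = (x - s) - (x - z) + s"
      using s by (auto simp: mem_cell)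
    then have "z \<in> (\<lambda>p. fst p - snd p + s) ` (M \<times> M)"
      by (intro image_eqI[where x = "(x - s, x - z)"]) auto
    then show "S' \<in> (\<lambda>z. S \<union> {z}) ` (int_lattice \<inter> (\<lambda>p. fst p - snd p + s) ` (M \<times> M))"
      using z by blast
  qed
  moreover have "finite (int_lattice \<inter> (\<lambda>p. fst p - snd p + s) ` (M \<times> M))"
    using assms
    by (intro finite_int_lattice_bounded compact_imp_bounded compact_continuous_image
        continuous_intros compact_Times)
  ultimately show ?thesis using finite_subset by blast
qed

text \<open>The translates of a compact set by lattice points are locally finite, so continuity on a closed
  ball follows from continuity on the finitely many translates meeting it.\<close>

lemma continuous_on_translates:
  fixes f :: "real ^ 'n \<Rightarrow> 'b::topological_space"
  assumes "compact M" and cover: "\<And>x. \<exists>s\<in>int_lattice. x - s \<in> M"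
    and cont: "\<And>s. s \<in> int_lattice \<Longrightarrow> continuous_on (cell M {s}) f"
  shows "continuous_on UNIV f"
proof -
  have "isCont f x" for x
  proof -
    define I where "I = int_lattice \<inter> (\<lambda>p. fst p - snd p) ` (cball x 1 \<times> M)"
    have "finite I" unfolding I_def
      using assms(1)
      by (intro finite_int_lattice_bounded compact_imp_bounded compact_continuous_image
          continuous_intros compact_Times compact_cball)
    have "continuous_on (\<Union>s\<in>I. cell M {s}) f"
      by (rule continuous_on_closed_Union)
        (use \<open>finite I\<close> assms(1) cont I_def in \<open>auto intro: closed_cell\<close>)
    moreover have "cball x 1 \<subseteq> (\<Union>s\<in>I. cell M {s})"
    proof
      fix y assume y: "y \<in> cball x 1"
      obtain s where s: "s \<in> int_lattice" "y - s \<in> M" using cover by blast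
      then have "s \<in> (\<lambda>p. fst p - snd p) ` (cball x 1 \<times> M)"
        using y by (intro image_eqI[where x = "(y, y - s)"]) auto
      then show "y \<in> (\<Union>s\<in>I. cell M {s})" using s by (auto simp: I_def mem_cell)
    qed
    ultimately have "continuous_on (cball x 1) f" by (rule continuous_on_subset)
    then show ?thesis
      by (rule continuous_on_interior) simp
  qed
  then show ?thesis by (simp add: continuous_at_imp_continuous_on)
qed

section \<open>Subdivided cells\<close>

text \<open>The intersection of the translates \<open>Z + D + A s\<close> for \<open>s \<in> S\<close>. For an ideal tile it is the
  realisation of the subdivision of \<open>S\<close>, but unlike that family of index sets it turns unions of
  index sets into intersections by definition.\<close>

definition subcell :: "real ^ 'n ^ 'n \<Rightarrow> (real ^ 'n) set \<Rightarrow> (real ^ 'n) set \<Rightarrow> (real ^ 'n) set \<Rightarrow> (real ^ 'n) set" where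
  "subcell A D Z S = {y. \<forall>s\<in>S. \<exists>d\<in>D. y - A *v s - d \<in> Z}"

lemma subcell_Un: "subcell A D Z (S \<union> S') = subcell A D Z S \<inter> subcell A D Z S'"
  by (auto simp: subcell_def)

lemma subcell_translate: "y + A *v z \<in> subcell A D Z ((+) z ` S) \<longleftrightarrow> y \<in> subcell A D Z S"
  by (simp add: subcell_def matrix_vector_right_distrib algebra_simps)

locale ideal_tile_setting =
  fixes A :: "real ^ 'n ^ 'n" and D T Z :: "(real ^ 'n) set"
  assumes tile: "self_affine_Zn_tile A D T" and ideal: "ideal_tile A D T Z"
begin

lemma integer_A: "integer_matrix A" and expanding_A: "expanding A"
  and residues: "residue_representatives A D" and zero_D: "0 \<in> D"
  and A_image_T: "(\<lambda>x. A *v x) ` T = T + D"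
  using tile by (auto simp: self_affine_Zn_tile_def self_affine_tile_def)

lemma D_subset: "D \<subseteq> int_lattice"
  using residues by (simp add: residue_representatives_def)

lemma A_lattice: "z \<in> int_lattice \<Longrightarrow> A *v z \<in> int_lattice"
  using integer_A by (rule int_lattice_integer_matrix)

lemma A_inj: "A *v x = A *v y \<Longrightarrow> x = y"
  using expanding_mult_eq_0[OF expanding_A, of "x - y"] by (simp add: matrix_vector_mult_diff_distrib)

lemma invertible_A: "invertible A"
  using expanding_mult_eq_0[OF expanding_A] matrix_left_invertible_ker[of A] invertible_left_inverse[of A] by blast

lemma A_inv_A: "A *v (matrix_inv A *v x) = x" and inv_A_A: "matrix_inv A *v (A *v x) = x"
proof -
  have "A ** matrix_inv A = mat 1 \<and> matrix_inv A ** A = mat 1"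
    unfolding matrix_inv_def by (rule someI_ex) (use invertible_A in \<open>simp add: invertible_def\<close>)
  then show "A *v (matrix_inv A *v x) = x" "matrix_inv A *v (A *v x) = x"
    by (simp_all add: matrix_vector_mul_assoc)
qed

lemma digit_decomposition:
  assumes "z \<in> int_lattice"
  obtains d s where "d \<in> D" "s \<in> int_lattice" "z = d + A *v s"
proof -
  obtain d where d: "d \<in> D" "z - d \<in> (\<lambda>w. A *v w) ` int_lattice"
    using residues assms unfolding residue_representatives_def by blast
  then obtain s where "s \<in> int_lattice" "z - d = A *v s" by blast
  with d(1) show ?thesis using that[of d s] by (simp add: algebra_simps)
qed

text \<open>The residue of \<open>d + A s\<close> determines the digit \<open>d\<close>, and then injectivity of \<open>A\<close> determines \<open>s\<close>.\<close>

lemma digit_decomposition_unique: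
  assumes "d \<in> D" "d' \<in> D" "s \<in> int_lattice" "s' \<in> int_lattice" "d + A *v s = d' + A *v s'"
  shows "s = s'"
proof -
  define z where "z = d + A *v s"
  have z: "z \<in> int_lattice"
    unfolding z_def using assms D_subset A_lattice int_lattice_add by blast
  have "z - d = A *v s" "z - d' = A *v s'"
    using assms(5) by (simp_all add: z_def algebra_simps)
  then have "z - d \<in> (\<lambda>w. A *v w) ` int_lattice" "z - d' \<in> (\<lambda>w. A *v w) ` int_lattice"
    using assms(3,4) \<open>z - d = _\<close> \<open>z - d' = _\<close> by auto
  then have "d = d'" using residues z assms(1,2) unfolding residue_representatives_def by blast
  then show ?thesis using assms(5) A_inj by simp
qed

lemma Zn_tile_Z: "Zn_tile Z" and connected_interior: "connected (interior Z)"
  and complex_eq: "tile_complex Z = tile_complex T"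
  using ideal by (auto simp: ideal_tile_def)

lemma connected_cell: "S \<in> tile_complex Z \<Longrightarrow> connected (cell Z S)"
  using ideal by (simp add: ideal_tile_def)

lemma extend_ideal:
  assumes "S \<in> tile_complex Z"
    "homeomorphism (cells Z (delta Z S)) (cells Z (delta_coll Z (subdiv A D T S))) h h'"
  shows "\<exists>g g'. homeomorphism (cell Z S) (cells Z (subdiv A D T S)) g g' \<and>
                (\<forall>x\<in>cells Z (delta Z S). g x = h x)"
  using ideal assms unfolding ideal_tile_def by blast

lemma compact_Z: "compact Z" and tiles_Z: "translates_tile Z"
  using Zn_tile_Z by (auto simp: Zn_tile_def)

lemma cover: "\<exists>s\<in>int_lattice. x - s \<in> Z"
proof -
  have "x \<in> (\<Union>z\<in>int_lattice. (\<lambda>x. x + z) ` Z)" using tiles_Z by (simp add: translates_tile_def)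
  then show ?thesis by (simp add: mem_translate)
qed

lemma address_ne: "address Z x \<noteq> {}"
  using cover by (auto simp: address_def)

lemma fin_address [simp]: "finite (address Z x)"
  by (rule finite_address[OF compact_Z])

lemma mem_cell_address: "x \<in> cell Z (address Z x)"
  by (auto simp: mem_cell address_def)

lemma complexD:
  assumes "S \<in> tile_complex Z"
  shows "S \<subseteq> int_lattice" "S \<noteq> {}" "cell Z S \<noteq> {}" "finite S"
proof -
  show "S \<subseteq> int_lattice" "S \<noteq> {}" "cell Z S \<noteq> {}" using assms by (auto simp: tile_complex_def)
  then obtain x where "S \<subseteq> address Z x" using mem_cell_iff_subset_address by blast
  then show "finite S" using finite_subset fin_address by blast
qed

lemma complexI: "S \<subseteq> int_lattice \<Longrightarrow> S \<noteq> {} \<Longrightarrow> x \<in> cell Z S \<Longrightarrow> S \<in> tile_complex Z"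
  by (auto simp: tile_complex_def)

text \<open>A point \<open>y\<close> of the right-hand side selects a digit \<open>p s\<close> for each \<open>s\<close>, and \<open>y\<close> itself witnesses
  that the index set \<open>{p s + A s | s \<in> S}\<close> belongs to the complex of \<open>Z\<close>, which is that of \<open>T\<close>.\<close>

lemma cells_subdiv:
  assumes "S \<subseteq> int_lattice" "S \<noteq> {}"
  shows "cells Z (subdiv A D T S) = subcell A D Z S"
proof (intro equalityI subsetI)
  fix y assume "y \<in> cells Z (subdiv A D T S)"
  then obtain p where "p \<in> S \<rightarrow> D" "y \<in> cell Z ((\<lambda>s. p s + A *v s) ` S)"
    by (auto simp: cells_def subdiv_def)
  then show "y \<in> subcell A D Z S"
    by (fastforce simp: subcell_def mem_cell algebra_simps)
next
  fix y assume "y \<in> subcell A D Z S"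
  then obtain p where p: "\<And>s. s \<in> S \<Longrightarrow> p s \<in> D" "\<And>s. s \<in> S \<Longrightarrow> y - A *v s - p s \<in> Z"
    unfolding subcell_def mem_Collect_eq by metis
  let ?Q = "(\<lambda>s. p s + A *v s) ` S"
  have y: "y \<in> cell Z ?Q" using p by (auto simp: mem_cell algebra_simps)
  have "?Q \<subseteq> int_lattice" using p(1) assms D_subset A_lattice int_lattice_add by blast
  then have "?Q \<in> tile_complex T" using complexI[OF _ _ y] assms complex_eq by simp
  then show "y \<in> cells Z (subdiv A D T S)"
    using y p(1) by (auto simp: cells_def subdiv_def intro!: bexI[of _ ?Q])
qed

text \<open>This is where the self-affinity of \<open>T\<close> is used. A subdivided index set of \<open>S\<close> has a point \<open>w\<close> in
  its \<open>T\<close>-cell, and \<open>w - A s \<in> T + D = A T\<close> for all \<open>s \<in> S\<close>, so \<open>A\<^sup>-\<^sup>1 w\<close> lies in the \<open>T\<close>-cell of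
  \<open>S\<close>. For \<open>Z\<close>, equality of the complexes is the only link between a cell and its subdivision.\<close>

lemma subcell_imp_complex:
  assumes "S \<subseteq> int_lattice" "S \<noteq> {}" "subcell A D Z S \<noteq> {}"
  shows "S \<in> tile_complex Z"
proof -
  have "cells Z (subdiv A D T S) \<noteq> {}" using assms cells_subdiv by simp
  then obtain p w where p: "p \<in> S \<rightarrow> D" and w: "w \<in> cell T ((\<lambda>s. p s + A *v s) ` S)"
    by (auto simp: cells_def subdiv_def tile_complex_def)
  have "matrix_inv A *v w - s \<in> T" if "s \<in> S" for s
  proof -
    have "w - (p s + A *v s) \<in> T" "p s \<in> D" using p w that by (auto simp: mem_cell)
    then have "(w - (p s + A *v s)) + p s \<in> T + D" by (rule set_plus_intro)
    then have "w - A *v s \<in> T + D" by (simp add: algebra_simps)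
    then obtain t where "t \<in> T" "w - A *v s = A *v t" using A_image_T by blast
    then show ?thesis
      by (metis A_inv_A inv_A_A matrix_vector_mult_diff_distrib)
  qed
  then have "matrix_inv A *v w \<in> cell T S" by (simp add: mem_cell)
  then show ?thesis using assms complex_eq by (auto simp: tile_complex_def)
qed

text \<open>The boundary of the subdivision is the subdivision of the boundary. What has to be seen is that
  an index \<open>x = d + A z\<close> which extends a member of the subdivision without belonging to any member
  has \<open>z \<notin> S\<close>: otherwise replacing the digit at \<open>z\<close> by \<open>d\<close> gives a member that contains \<open>x\<close>.
  Conversely, by uniqueness of the digit expansion, \<open>z \<notin> S\<close> keeps \<open>x\<close> out of all members.\<close>

lemma cells_delta_subdiv:
  assumes "S \<subseteq> int_lattice" "S \<noteq> {}"
  shows "cells Z (delta_coll Z (subdiv A D T S)) = (\<Union>z\<in>int_lattice - S. subcell A D Z (insert z S))"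
proof (intro equalityI subsetI)
  fix y assume "y \<in> cells Z (delta_coll Z (subdiv A D T S))"
  then obtain p x where p: "p \<in> S \<rightarrow> D" and x: "x \<in> int_lattice" "x \<notin> \<Union>(subdiv A D T S)"
    and y: "y \<in> cell Z ((\<lambda>s. p s + A *v s) ` S)" "y - x \<in> Z"
    by (auto simp: cells_def delta_coll_def subdiv_def mem_cell)
  obtain d z where dz: "d \<in> D" "z \<in> int_lattice" "x = d + A *v z"
    using digit_decomposition[OF x(1)] .
  have "z \<notin> S"
  proof
    assume zS: "z \<in> S"
    define q where "q = p(z := d)"
    have q: "q \<in> S \<rightarrow> D" using p dz by (auto simp: q_def)
    let ?Q = "(\<lambda>s. q s + A *v s) ` S"
    have yQ: "y \<in> cell Z ?Q" using y dz(3) by (auto simp: q_def mem_cell)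
    have "?Q \<subseteq> int_lattice" using q assms D_subset A_lattice int_lattice_add by blast
    then have "?Q \<in> tile_complex T" using complexI[OF _ _ yQ] assms complex_eq by simp
    then have "?Q \<in> subdiv A D T S" using q by (auto simp: subdiv_def)
    moreover have "x \<in> ?Q" using zS dz(3) by (auto simp: q_def intro!: image_eqI[of _ _ z])
    ultimately show False using x(2) by blast
  qed
  moreover have "y \<in> subcell A D Z (insert z S)"
    using p y dz by (fastforce simp: subcell_def mem_cell algebra_simps)
  ultimately show "y \<in> (\<Union>z\<in>int_lattice - S. subcell A D Z (insert z S))" using dz by blast
next
  fix y assume "y \<in> (\<Union>z\<in>int_lattice - S. subcell A D Z (insert z S))"
  then obtain z where z: "z \<in> int_lattice" "z \<notin> S" and y: "y \<in> subcell A D Z (insert z S)" by blast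
  then obtain p where p: "\<And>s. s \<in> insert z S \<Longrightarrow> p s \<in> D"
    "\<And>s. s \<in> insert z S \<Longrightarrow> y - A *v s - p s \<in> Z"
    unfolding subcell_def mem_Collect_eq by metis
  let ?Q = "(\<lambda>s. p s + A *v s) ` S" and ?x = "p z + A *v z"
  have yQ: "y \<in> cell Z (?Q \<union> {?x})" using p by (auto simp: mem_cell algebra_simps)
  then have yQ': "y \<in> cell Z ?Q" by (simp add: mem_cell)
  have Q: "?Q \<subseteq> int_lattice" using p(1) assms D_subset A_lattice int_lattice_add by blast
  have x: "?x \<in> int_lattice" using p(1) z D_subset A_lattice int_lattice_add by blast
  have "?Q \<in> tile_complex T" using complexI[OF Q _ yQ'] assms complex_eq by simp
  then have "?Q \<in> subdiv A D T S" using p(1) by (auto simp: subdiv_def)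
  moreover have "?x \<notin> \<Union>(subdiv A D T S)"
  proof
    assume "?x \<in> \<Union>(subdiv A D T S)"
    then obtain q s where q: "q \<in> S \<rightarrow> D" "s \<in> S" "?x = q s + A *v s" by (auto simp: subdiv_def)
    then have "z = s" using digit_decomposition_unique[of "p z" "q s" z s] p(1) z assms by blast
    then show False using q z by simp
  qed
  moreover have "?Q \<union> {?x} \<in> tile_complex Z" using complexI[OF _ _ yQ] Q x by simp
  ultimately have "?Q \<union> {?x} \<in> delta_coll Z (subdiv A D T S)" using x unfolding delta_coll_def by blast
  then show "y \<in> cells Z (delta_coll Z (subdiv A D T S))" using yQ by (auto simp: cells_def)
qed

section \<open>Maps on skeleta\<close>

text \<open>A correct restriction of the desired homeomorphism to the \<open>k\<close>-th skeleton. The values of \<open>F\<close>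
  elsewhere are arbitrary; taking a total function instead of a family of maps on cells makes
  agreement on common faces automatic.\<close>

definition skeletal_map :: "nat \<Rightarrow> (real ^ 'n \<Rightarrow> real ^ 'n) \<Rightarrow> bool" where
  "skeletal_map k F \<longleftrightarrow>
     (\<forall>S\<in>tile_complex Z. k \<le> card S \<longrightarrow>
        continuous_on (cell Z S) F \<and> inj_on F (cell Z S) \<and> F ` cell Z S = subcell A D Z S) \<and>
     (\<forall>x. k \<le> card (address Z x) \<longrightarrow> (\<forall>z\<in>int_lattice. F (x + z) = F x + A *v z))"

lemma skeletal_mapD:
  assumes "skeletal_map k F" "S \<in> tile_complex Z" "k \<le> card S"
  shows "continuous_on (cell Z S) F" "inj_on F (cell Z S)" "F ` cell Z S = subcell A D Z S"
  using assms by (auto simp: skeletal_map_def)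

lemma skeletal_map_translate:
  "skeletal_map k F \<Longrightarrow> k \<le> card (address Z x) \<Longrightarrow> z \<in> int_lattice \<Longrightarrow> F (x + z) = F x + A *v z"
  by (auto simp: skeletal_map_def)

text \<open>A common value lies in the targets of both cells, hence in the target of \<open>S \<union> S'\<close>, which is
  attained on \<open>cell Z (S \<union> S')\<close>; injectivity on each of the two cells identifies both arguments
  with that preimage.\<close>

lemma skeletal_map_inj:
  assumes F: "skeletal_map k F" and S: "S \<in> tile_complex Z" "k \<le> card S"
    and S': "S' \<in> tile_complex Z" "k \<le> card S'"
    and x: "x \<in> cell Z S" and y: "y \<in> cell Z S'" and eq: "F x = F y"
  shows "x = y"
proof -
  have "F x \<in> subcell A D Z S" "F y \<in> subcell A D Z S'"
    using skeletal_mapD(3)[OF F] S S' x y by auto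
  then have mem: "F x \<in> subcell A D Z (S \<union> S')" using eq by (simp add: subcell_Un)
  have U: "S \<union> S' \<in> tile_complex Z"
    by (rule subcell_imp_complex) (use mem complexD[OF S(1)] complexD[OF S'(1)] in auto)
  have "k \<le> card (S \<union> S')"
    using S(2) card_mono[of "S \<union> S'" S] complexD(4)[OF U] by simp
  then obtain v where v: "v \<in> cell Z (S \<union> S')" "F v = F x"
    using skeletal_mapD(3)[OF F U] mem by (metis imageE)
  then have "v \<in> cell Z S" "v \<in> cell Z S'" by (auto simp: mem_cell)
  then show ?thesis
    using skeletal_mapD(2)[OF F S] skeletal_mapD(2)[OF F S'] v(2) x y eq
    by (metis inj_onD)
qed

text \<open>The given map is a homeomorphism between the boundary of the cell and the boundary of its
  target, so the extension property of the ideal tile applies. When the boundary is empty, this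
  is the extension of the empty map.\<close>

lemma skeletal_map_extend_cell:
  assumes F: "skeletal_map (Suc k) F" and S: "S \<in> tile_complex Z" "card S = k"
  shows "\<exists>g. continuous_on (cell Z S) g \<and> inj_on g (cell Z S) \<and> g ` cell Z S = subcell A D Z S \<and>
            (\<forall>x\<in>cells Z (delta Z S). g x = F x)"
proof -
  note SD = complexD[OF S(1)]
  let ?B = "cells Z (delta Z S)"
  have del: "S' \<in> tile_complex Z" "Suc k \<le> card S'" if "S' \<in> delta Z S" for S'
    using that S SD by (auto simp: delta_def)
  have fin: "finite (delta Z S)" using finite_delta[OF compact_Z SD(2)] .
  have closed: "closed (cell Z S')" for S' by (rule closed_cell[OF compact_Z])
  have "compact ?B" unfolding cells_def
    using fin del complexD(2) compact_cell[OF compact_Z] by (intro compact_UN) auto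
  moreover have "continuous_on ?B F" unfolding cells_def
    by (rule continuous_on_closed_Union) (use fin closed del skeletal_mapD(1)[OF F] in auto)
  moreover have "F ` ?B = cells Z (delta_coll Z (subdiv A D T S))"
  proof -
    have "F ` ?B = (\<Union>S'\<in>delta Z S. subcell A D Z S')"
      unfolding cells_def image_UN using skeletal_mapD(3)[OF F] del by auto
    also have "\<dots> = (\<Union>z\<in>int_lattice - S. subcell A D Z (insert z S))"
    proof (intro equalityI subsetI)
      fix y assume "y \<in> (\<Union>z\<in>int_lattice - S. subcell A D Z (insert z S))"
      then obtain z where z: "z \<in> int_lattice - S" "y \<in> subcell A D Z (insert z S)" by blast
      then have "insert z S \<in> tile_complex Z"
        using SD(1) by (intro subcell_imp_complex) auto
      then have "insert z S \<in> delta Z S" using z by (auto simp: delta_def)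
      then show "y \<in> (\<Union>S'\<in>delta Z S. subcell A D Z S')" using z by blast
    qed (auto simp: delta_def)
    finally show ?thesis using cells_delta_subdiv SD by simp
  qed
  moreover have "inj_on F ?B"
  proof (rule inj_onI)
    fix x y assume xy: "x \<in> ?B" "y \<in> ?B" "F x = F y"
    then obtain S1 S2 where "S1 \<in> delta Z S" "x \<in> cell Z S1" "S2 \<in> delta Z S" "y \<in> cell Z S2"
      unfolding cells_def by blast
    then show "x = y" using skeletal_map_inj[OF F] del xy(3) by metis
  qed
  ultimately obtain h' where "homeomorphism ?B (cells Z (delta_coll Z (subdiv A D T S))) F h'"
    using homeomorphism_compact by blast
  from extend_ideal[OF S(1) this] obtain g g' where
    g: "homeomorphism (cell Z S) (cells Z (subdiv A D T S)) g g'" "\<forall>x\<in>?B. g x = F x" by blast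
  moreover have "inj_on g (cell Z S)"
    using g(1) by (metis homeomorphism_apply1 inj_on_inverseI)
  ultimately show ?thesis
    using cells_subdiv SD by (auto simp: homeomorphism_def intro!: exI[of _ g])
qed

text \<open>The open parts of the cells with \<open>k\<close> indices are disjoint, as they are told apart by the address,
  so each can be filled independently. The filling \<open>G S\<close> is the one chosen for the
  representative \<open>R S\<close> of the orbit of \<open>S\<close>, transported by the anchor \<open>c S\<close> of \<open>S\<close>; on the boundary
  of the cell it agrees with \<open>F\<close> because \<open>F\<close> is equivariant.\<close>

lemma skeletal_map_descend:
  assumes F: "skeletal_map (Suc k) F"
  shows "\<exists>F'. skeletal_map k F'"
proof -
  obtain g where g: "\<And>S. S \<in> tile_complex Z \<Longrightarrow> card S = k \<Longrightarrow>
      continuous_on (cell Z S) (g S) \<and> inj_on (g S) (cell Z S) \<and> g S ` cell Z S = subcell A D Z S \<and>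
      (\<forall>x\<in>cells Z (delta Z S). g S x = F x)"
    using skeletal_map_extend_cell[OF F] by metis
  obtain c :: "(real ^ 'n) set \<Rightarrow> real ^ 'n" where
    c: "\<And>S. finite S \<Longrightarrow> S \<noteq> {} \<Longrightarrow> c S \<in> int_lattice"
    "\<And>S z. finite S \<Longrightarrow> S \<noteq> {} \<Longrightarrow> z \<in> int_lattice \<Longrightarrow> c ((+) z ` S) = c S + z"
    using exists_equivariant_anchor by metis
  define R where "R S = (+) (- c S) ` S" for S
  define G where "G S x = g (R S) (x - c S) + A *v c S" for S x
  define F' where "F' x = (if card (address Z x) = k then G (address Z x) x else F x)" for x
  have G_translate: "G ((+) z ` S) (x + z) = G S x + A *v z"
    if "finite S" "S \<noteq> {}" "z \<in> int_lattice" for S x z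
  proof -
    have "R ((+) z ` S) = R S"
      unfolding R_def c(2)[OF that] by (simp add: image_image algebra_simps)
    then show ?thesis unfolding G_def c(2)[OF that] by (simp add: matrix_vector_right_distrib algebra_simps)
  qed
  have S_R: "S = (+) (c S) ` R S" for S
    by (simp add: R_def image_image)
  have R: "R S \<in> tile_complex Z" "card (R S) = card S" if S: "S \<in> tile_complex Z" for S
  proof -
    note SD = complexD[OF S]
    obtain x where x: "x \<in> cell Z S" using SD by blast
    then have "x - c S \<in> cell Z (R S)"
      using cell_translate[of "x - c S" "c S" Z "R S"] S_R[of S] by simp
    moreover have "R S \<subseteq> int_lattice"
      using SD c(1)[of S] int_lattice_add int_lattice_uminus unfolding R_def by blast
    ultimately show "R S \<in> tile_complex Z" using complexI SD(2) by (simp add: R_def)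
    show "card (R S) = card S" unfolding R_def by (rule card_image) simp
  qed
  have F'_G: "F' x = G S x" if S: "S \<in> tile_complex Z" "card S = k" and x: "x \<in> cell Z S" for S x
  proof (cases "address Z x = S")
    case True
    then show ?thesis using S by (simp add: F'_def)
  next
    case False
    note SD = complexD[OF S(1)]
    have "S \<subset> address Z x" using x False mem_cell_iff_subset_address[OF SD(1)] by blast
    then obtain s where s: "s \<in> address Z x - S" by blast
    have card: "k < card (address Z x)" using \<open>S \<subset> _\<close> S(2) psubset_card_mono fin_address by blast
    have cS: "c S \<in> int_lattice" using c(1) SD by blast
    have "s - c S \<in> int_lattice - R S" 
      using s cS int_lattice_diff by (auto simp: address_def R_def)
    moreover have "x - c S \<in> cell Z (insert (s - c S) (R S))"
      using x s by (auto simp: mem_cell address_def R_def)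
    ultimately have "x - c S \<in> cells Z (delta Z (R S))"
      using complexD(1)[OF R(1)[OF S(1)]] by (auto simp: mem_cells_delta)
    then have "G S x = F (x - c S) + A *v c S"
      unfolding G_def using g[of "R S"] R[OF S(1)] S(2) by simp
    moreover have "card (address Z (x - c S)) = card (address Z x)"
      using address_translate[OF int_lattice_uminus[OF cS], of Z x] by (simp add: card_image)
    then have "F ((x - c S) + c S) = F (x - c S) + A *v c S"
      using card cS by (intro skeletal_map_translate[OF F]) auto
    ultimately show ?thesis using card by (simp add: F'_def)
  qed
  \<comment> \<open>On a cell with exactly \<open>k\<close> indices the new map is a translated filling; on one with more
     indices it is still \<open>F\<close>.\<close>
  have base: "continuous_on (cell Z S) F' \<and> inj_on F' (cell Z S) \<and> F' ` cell Z S = subcell A D Z S"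
    if S: "S \<in> tile_complex Z" "card S = k" for S
  proof -
    note gR = g[OF R(1)[OF S(1)], unfolded R(2)[OF S(1)], OF S(2)]
    have sh: "x \<in> cell Z S \<longleftrightarrow> x - c S \<in> cell Z (R S)" for x
      using cell_translate[of "x - c S" "c S" Z "R S"] S_R[of S] by simp
    have shs: "y \<in> subcell A D Z S \<longleftrightarrow> y - A *v c S \<in> subcell A D Z (R S)" for y
      using subcell_translate[of "y - A *v c S" A "c S" D Z "R S"] S_R[of S] by simp
    have "continuous_on (cell Z S) (G S)" unfolding G_def
      by (intro continuous_intros continuous_on_compose2[OF conjunct1[OF gR]]) (auto simp: sh)
    moreover have "inj_on (G S) (cell Z S)"
    proof (rule inj_onI)
      fix x y assume "x \<in> cell Z S" "y \<in> cell Z S" "G S x = G S y"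
      then have "x - c S = y - c S" using gR by (auto simp: G_def sh dest: inj_onD)
      then show "x = y" by simp
    qed
    moreover have "G S ` cell Z S = subcell A D Z S"
    proof (intro equalityI subsetI)
      fix y assume "y \<in> G S ` cell Z S"
      then show "y \<in> subcell A D Z S" using gR by (auto simp: G_def sh shs)
    next
      fix y assume "y \<in> subcell A D Z S"
      then have "y - A *v c S \<in> g (R S) ` cell Z (R S)" using gR by (auto simp: shs)
      then obtain x where "x \<in> cell Z (R S)" "y - A *v c S = g (R S) x" by blast
      then show "y \<in> G S ` cell Z S"
        by (intro image_eqI[of _ _ "x + c S"]) (auto simp: G_def sh algebra_simps)
    qed
    ultimately show ?thesis
      using F'_G[OF S] by (simp cong: continuous_on_cong inj_on_cong image_cong)
  qed
  have upper: "continuous_on (cell Z S) F' \<and> inj_on F' (cell Z S) \<and> F' ` cell Z S = subcell A D Z S"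
    if S: "S \<in> tile_complex Z" "Suc k \<le> card S" for S
  proof -
    have "F' x = F x" if "x \<in> cell Z S" for x
    proof -
      have "card S \<le> card (address Z x)"
        using that mem_cell_iff_subset_address complexD(1)[OF S(1)] card_mono fin_address by metis
      then show ?thesis using S by (simp add: F'_def)
    qed
    then show ?thesis
      using skeletal_mapD[OF F S] by (simp cong: continuous_on_cong inj_on_cong image_cong)
  qed
  have "F' (x + z) = F' x + A *v z" if "k \<le> card (address Z x)" "z \<in> int_lattice" for x z
  proof -
    have "card (address Z (x + z)) = card (address Z x)"
      using address_translate[OF that(2)] by (simp add: card_image)
    then show ?thesis
      using that G_translate[OF fin_address address_ne that(2), of x x]
        skeletal_map_translate[OF F, of x z] address_translate[OF that(2), of Z x]
      by (auto simp: F'_def)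
  qed
  then have "skeletal_map k F'"
    unfolding skeletal_map_def using base upper by (metis le_antisym not_less_eq_eq)
  then show ?thesis by blast
qed

lemma exists_skeletal_map: "\<exists>F. skeletal_map k F"
proof -
  obtain N where N: "\<And>x. card (address Z x) \<le> N" using card_address_bounded[OF compact_Z] by blast
  have "card S \<le> N" if S: "S \<in> tile_complex Z" for S
  proof -
    obtain x where "x \<in> cell Z S" using complexD(3)[OF S] by blast
    then have "card S \<le> card (address Z x)"
      using mem_cell_iff_subset_address complexD(1)[OF S] card_mono fin_address by metis
    then show ?thesis using N order_trans by blast
  qed
  then have "\<not> j \<le> card S" if "Suc N \<le> j" "S \<in> tile_complex Z" for j S
    using that by (meson Suc_le_eq leD le_trans)
  moreover have "\<not> j \<le> card (address Z x)" if "Suc N \<le> j" for j x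
    using N[of x] that by linarith
  ultimately have vac: "skeletal_map j F" if "Suc N \<le> j" for j F
    unfolding skeletal_map_def using that by blast
  show ?thesis
  proof (cases "k \<le> Suc N")
    case True
    then show ?thesis
    proof (induction rule: inc_induct)
      case base
      show ?case using vac[OF order_refl] by blast
    next
      case (step n)
      then show ?case using skeletal_map_descend by blast
    qed
  next
    case False
    then show ?thesis using vac by auto
  qed
qed

section \<open>The global homeomorphism\<close>

lemma exists_equivariant_homeomorphism:
  "\<exists>F G. homeomorphism UNIV UNIV F G \<and> F ` Z = Z + D \<and>
     (\<forall>x. \<forall>z\<in>int_lattice. F (x + z) = F x + A *v z)"
proof -
  obtain F where F: "skeletal_map 1 F" using exists_skeletal_map by blast
  have card: "1 \<le> card (address Z x)" for x
    using address_ne[of x] by (simp add: Suc_le_eq card_gt_0_iff)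
  have Fz: "F (x + z) = F x + A *v z" if "z \<in> int_lattice" for x z
    using skeletal_map_translate[OF F card that] .
  have ac: "address Z x \<in> tile_complex Z" for x
    using complexI[OF address_subset address_ne mem_cell_address] .
  have inj: "inj F"
    using skeletal_map_inj[OF F ac card ac card mem_cell_address mem_cell_address] by (intro injI)
  have single: "cell Z {s} = {} \<or> {s} \<in> tile_complex Z" if "s \<in> int_lattice" for s
    using that by (auto simp: tile_complex_def)
  have cont: "continuous_on UNIV F"
  proof (rule continuous_on_translates[OF compact_Z cover])
    fix s :: "real ^ 'n" assume "s \<in> int_lattice"
    then show "continuous_on (cell Z {s}) F"
      using single[of s] skeletal_mapD(1)[OF F, of "{s}"] by auto
  qed
  have "Z \<noteq> {}" using cover by blast
  then have "{0} \<in> tile_complex Z" by (auto simp: tile_complex_def mem_cell)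
  then have "F ` cell Z {0} = subcell A D Z {0}" using skeletal_mapD(3)[OF F] by simp
  moreover have "cell Z {0} = Z" by (auto simp: mem_cell)
  moreover have "subcell A D Z {0} = Z + D"
  proof (intro equalityI subsetI)
    fix y assume "y \<in> subcell A D Z {0}"
    then obtain d where "d \<in> D" "y - d \<in> Z" by (auto simp: subcell_def)
    then show "y \<in> Z + D" using set_plus_intro[of "y - d" Z d D] by simp
  next
    fix y assume "y \<in> Z + D"
    then obtain a d where "a \<in> Z" "d \<in> D" "y = a + d" by (elim set_plus_elim)
    then show "y \<in> subcell A D Z {0}"
      by (auto simp: subcell_def intro!: bexI[of _ d])
  qed
  ultimately have FZ: "F ` Z = Z + D" by simp
  \<comment> \<open>A point of \<open>Z + s\<close> with \<open>s = d + A t\<close> lies in \<open>Z + D + A t\<close>, the image of \<open>Z + t\<close>.\<close>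
  have "surj F"
  proof -
    have "y \<in> range F" for y
    proof -
      obtain s where s: "s \<in> int_lattice" "y - s \<in> Z" using cover by blast
      obtain d t where dt: "d \<in> D" "t \<in> int_lattice" "s = d + A *v t"
        using digit_decomposition[OF s(1)] .
      have "(y - s) + d \<in> F ` Z" unfolding FZ using s dt by (intro set_plus_intro)
      then obtain x where "F x = y - A *v t" using dt(3) by (auto simp: algebra_simps)
      then have "F (x + t) = y" using Fz dt(2) by simp
      then show ?thesis by blast
    qed
    then show ?thesis by blast
  qed
  obtain G where "homeomorphism UNIV (range F) F G"
    using invariance_of_domain_homeomorphism[OF open_UNIV cont _ inj] by auto
  then show ?thesis using FZ Fz \<open>surj F\<close> by auto
qed

text \<open>As \<open>Z\<close> is the closure of its interior, an open set that misses the interior of a translate misses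
  the whole translate.\<close>

lemma interior_meets_translate:
  assumes "s \<in> int_lattice" "t \<in> int_lattice" "x - s \<in> interior Z" "x - t \<in> Z"
  shows "s = t"
proof (rule ccontr)
  assume "s \<noteq> t"
  have int: "interior ((\<lambda>x. x + r) ` Z) = (\<lambda>x. x + r) ` interior Z" for r
    using interior_translation[of r Z] by (simp add: add.commute)
  have cl: "(\<lambda>x. x + t) ` Z = closure ((\<lambda>x. x + t) ` interior Z)"
    using closure_translation[of t "interior Z"] Zn_tile_Z by (simp add: add.commute Zn_tile_def)
  have "x \<in> interior ((\<lambda>x. x + s) ` Z)" using assms by (simp add: int mem_translate)
  moreover have "x \<in> closure (interior ((\<lambda>x. x + t) ` Z))"
    using assms(4) cl int by (metis mem_translate)
  ultimately have "interior ((\<lambda>x. x + s) ` Z) \<inter> interior ((\<lambda>x. x + t) ` Z) \<noteq> {}"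
    using open_Int_closure_eq_empty open_interior by blast
  then show False using assms \<open>s \<noteq> t\<close> tiles_Z by (auto simp: translates_tile_def)
qed

text \<open>The extension of \<open>f\<close> on \<open>Z\<close> to a map commuting with lattice translations. The choice of
  the translate containing \<open>x\<close> is immaterial when \<open>f\<close> is the identity outside the interior of \<open>Z\<close>
  (\<open>periodize_eq\<close>), since distinct translates overlap only in boundary points.\<close>

definition periodize :: "(real ^ 'n \<Rightarrow> real ^ 'n) \<Rightarrow> real ^ 'n \<Rightarrow> real ^ 'n" where
  "periodize f x = f (x - (SOME s. s \<in> int_lattice \<and> x - s \<in> Z)) +
     (SOME s. s \<in> int_lattice \<and> x - s \<in> Z)"

lemma periodize_eq:
  assumes f: "\<And>x. x \<notin> interior Z \<Longrightarrow> f x = x" and s: "s \<in> int_lattice" "x - s \<in> Z"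
  shows "periodize f x = f (x - s) + s"
proof -
  define t where "t = (SOME s. s \<in> int_lattice \<and> x - s \<in> Z)"
  have t: "t \<in> int_lattice \<and> x - t \<in> Z" unfolding t_def by (rule someI_ex) (use s in blast)
  have "f (x - t) + t = f (x - s) + s"
  proof (cases "x - s \<in> interior Z \<or> x - t \<in> interior Z")
    case True
    then have "s = t" using interior_meets_translate s t by metis
    then show ?thesis by simp
  next
    case False
    then show ?thesis using f by simp
  qed
  then show ?thesis by (simp add: periodize_def t_def)
qed

lemma periodize_translate:
  assumes f: "\<And>x. x \<notin> interior Z \<Longrightarrow> f x = x" and z: "z \<in> int_lattice"
  shows "periodize f (x + z) = periodize f x + z"
proof -
  obtain s where s: "s \<in> int_lattice" "x - s \<in> Z" using cover by blast
  have "periodize f (x + z) = f (x + z - (s + z)) + (s + z)"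
    by (rule periodize_eq) (use f s z int_lattice_add in auto)
  then show ?thesis
    using periodize_eq[where f = f, OF f s] by (simp add: algebra_simps)
qed

lemma continuous_periodize:
  assumes f: "\<And>x. x \<notin> interior Z \<Longrightarrow> f x = x" and cont: "continuous_on UNIV f"
  shows "continuous_on UNIV (periodize f)"
proof (rule continuous_on_translates[OF compact_Z cover])
  fix s :: "real ^ 'n" assume s: "s \<in> int_lattice"
  have "continuous_on (cell Z {s}) (\<lambda>x. f (x - s) + s)"
    by (intro continuous_intros continuous_on_compose2[OF cont]) auto
  then show "continuous_on (cell Z {s}) (periodize f)"
    by (rule continuous_on_eq) (use periodize_eq[where f = f, OF f s] in \<open>simp add: mem_cell\<close>)
qed

lemma periodize_inverse:
  assumes f: "\<And>x. x \<notin> interior Z \<Longrightarrow> f x = x" and g: "\<And>x. x \<notin> interior Z \<Longrightarrow> g x = x"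
    and gf: "\<And>x. g (f x) = x" 
  shows "periodize g (periodize f x) = x"
proof -
  obtain s where s: "s \<in> int_lattice" "x - s \<in> Z" using cover by blast
  have "f (x - s) \<in> Z"
  proof (rule ccontr)
    assume "f (x - s) \<notin> Z"
    then have "g (f (x - s)) = f (x - s)" using g interior_subset by blast
    then show False using gf s(2) \<open>f (x - s) \<notin> Z\<close> by simp
  qed
  then show ?thesis
    using periodize_eq[where f = f, OF f s] periodize_eq[where f = g and x = "f (x - s) + s", OF g s(1)] gf by simp
qed

lemma exists_periodic_homeomorphism_moving:
  assumes "a \<in> interior Z" "b \<in> interior Z"
  shows "\<exists>H H'. homeomorphism UNIV UNIV H H' \<and> H a = b \<and> H ` Z = Z \<and>
     (\<forall>x. \<forall>z\<in>int_lattice. H (x + z) = H x + z)"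
proof -
  have "affine hull (interior Z) = UNIV"
    using affine_hull_open[OF open_interior, of Z] assms by auto
  obtain f g where fg: "homeomorphism UNIV UNIV f g" "f a = b"
    "{x. \<not> (f x = x \<and> g x = x)} \<subseteq> interior Z"
  proof (rule homeomorphism_moving_point[where S = "interior Z" and T = UNIV and a = a and b = b])
    show "openin (top_of_set (affine hull interior Z)) (interior Z)"
      using \<open>affine hull interior Z = UNIV\<close> by simp
    show "(UNIV :: (real ^ 'n) set) \<subseteq> affine hull interior Z"
      using \<open>affine hull interior Z = UNIV\<close> by simp
  qed (use assms connected_interior in auto)
  have f: "f x = x" if "x \<notin> interior Z" for x using fg(3) that by blast
  have g: "g x = x" if "x \<notin> interior Z" for x using fg(3) that by blast
  have inv: "g (f x) = x" "f (g x) = x" for x using fg(1) by (auto simp: homeomorphism_def)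
  have "continuous_on UNIV f" "continuous_on UNIV g" using fg(1) by (auto simp: homeomorphism_def)
  have hom: "homeomorphism UNIV UNIV (periodize f) (periodize g)"
    using continuous_periodize[OF f \<open>continuous_on UNIV f\<close>] continuous_periodize[OF g \<open>continuous_on UNIV g\<close>]
      periodize_inverse[OF f g inv(1)] periodize_inverse[OF g f inv(2)]
    by (auto intro!: homeomorphismI)
  have on_Z: "periodize f x = f x" if "x \<in> Z" for x
    using periodize_eq[where f = f and s = 0 and x = x, OF f] that by simp
  have maps: "f x \<in> Z" "g x \<in> Z" if "x \<in> Z" for x
    using that f g inv interior_subset by (metis subsetD)+
  have "periodize f ` Z = Z"
  proof (intro equalityI subsetI)
    fix y assume "y \<in> Z"
    then show "y \<in> periodize f ` Z"
      using maps(2) on_Z inv(2) by (intro image_eqI[of _ _ "g y"]) auto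
  qed (use on_Z maps(1) in auto)
  moreover have "periodize f a = b" using on_Z assms interior_subset fg(2) by (metis subsetD)
  ultimately show ?thesis using hom periodize_translate[OF f] by blast
qed

text \<open>The point \<open>F\<^sup>-\<^sup>1 u\<close> lies in the interior of \<open>Z\<close>: as \<open>0 \<in> D\<close>, the interior of \<open>Z\<close> is an open
  subset of \<open>F Z = Z + D\<close>, so its preimage is an open subset of \<open>Z\<close>. Moving \<open>u\<close> there before
  applying \<open>F\<close> gives the fixed point.\<close>

lemma exists_equivariant_homeomorphism_fixing:
  assumes u: "u \<in> interior Z"
  shows "\<exists>F G. homeomorphism UNIV UNIV F G \<and> F ` Z = Z + D \<and>
     (\<forall>x. \<forall>z\<in>int_lattice. F (x + z) = F x + A *v z) \<and> F u = u"
proof -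
  obtain F G where F: "homeomorphism UNIV UNIV F G" "F ` Z = Z + D"
    "\<forall>x. \<forall>z\<in>int_lattice. F (x + z) = F x + A *v z"
    using exists_equivariant_homeomorphism by blast
  have inv: "G (F x) = x" "F (G x) = x" for x using F(1) by (auto simp: homeomorphism_def)
  have "G u \<in> interior Z"
  proof -
    have "Z \<subseteq> Z + D"
    proof
      fix z assume "z \<in> Z"
      then show "z \<in> Z + D" using zero_D set_plus_intro[of z Z 0 D] by simp
    qed
    then have "G ` interior Z \<subseteq> G ` F ` Z"
      unfolding F(2) by (intro image_mono) (use interior_subset in blast)
    then have "G ` interior Z \<subseteq> Z" by (simp add: image_image inv(1))
    moreover have "open (G ` interior Z)"
    proof -
      have "openin (top_of_set UNIV) (interior Z)" by simp
      then have "openin (top_of_set UNIV) (G ` interior Z)"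
        using homeomorphism_imp_open_map[OF homeomorphism_symD[OF F(1)]] by blast
      then show ?thesis by simp
    qed
    ultimately have "G ` interior Z \<subseteq> interior Z" by (rule interior_maximal)
    then show ?thesis using u by blast
  qed
  then obtain H H' where H: "homeomorphism UNIV UNIV H H'" "H u = G u" "H ` Z = Z"
    "\<forall>x. \<forall>z\<in>int_lattice. H (x + z) = H x + z"
    using exists_periodic_homeomorphism_moving[OF u \<open>G u \<in> interior Z\<close>] by blast
  have "homeomorphism UNIV UNIV (F \<circ> H) (H' \<circ> G)"
    using homeomorphism_compose[OF H(1) F(1)] .
  moreover have "(F \<circ> H) ` Z = Z + D" using H(3) F(2) by (simp only: image_comp[symmetric])
  moreover have "\<forall>x. \<forall>z\<in>int_lattice. (F \<circ> H) (x + z) = (F \<circ> H) x + A *v z"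
    using H(4) F(3) by simp
  moreover have "(F \<circ> H) u = u" using H(2) inv(2) by simp
  ultimately show ?thesis by blast
qed

end

section \<open>Translating a tile\<close>

lemma cell_translated_tile: "cell ((\<lambda>x. x - u) ` M) S = (\<lambda>x. x - u) ` cell M S"
proof -
  have *: "x \<in> (\<lambda>x. x - u) ` N \<longleftrightarrow> x + u \<in> N" for x N
    using mem_translate[of x "- u" N] by simp
  show ?thesis by (rule set_eqI) (simp add: mem_cell * algebra_simps)
qed

lemma tile_complex_translated_tile: "tile_complex ((\<lambda>x. x - u) ` M) = tile_complex M"
  by (simp add: tile_complex_def cell_translated_tile)

lemma Zn_tile_translated_tile:
  assumes "Zn_tile M"
  shows "Zn_tile ((\<lambda>x. x - u) ` M)"
proof -
  have eq: "(\<lambda>x. x - u) = (+) (- u)" by (auto simp: fun_eq_iff)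
  have int: "interior ((+) v ` N) = (+) v ` interior N" for v and N :: "(real ^ 'a) set"
    by (rule interior_translation)
  have comm: "(\<lambda>x. x + z) ` ((+) v ` N) = (+) v ` ((\<lambda>x. x + z) ` N)" for v z and N :: "(real ^ 'a) set"
    by (simp add: image_image algebra_simps)
  have "compact ((+) (- u) ` M)"
    using assms by (intro compact_translation) (simp add: Zn_tile_def)
  moreover have "closure (interior ((+) (- u) ` M)) = (+) (- u) ` M"
    using assms by (simp only: int closure_translation Zn_tile_def)
  moreover have "frontier ((+) (- u) ` M) \<in> null_sets lebesgue"
    using assms by (simp only: frontier_translation Zn_tile_def negligible_iff_null_sets[symmetric] negligible_translation)
  moreover have "translates_tile ((+) (- u) ` M)"
  proof -
    have t: "translates_tile M" using assms by (simp add: Zn_tile_def)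
    have "(\<Union>z\<in>int_lattice. (\<lambda>x. x + z) ` ((+) (- u) ` M)) = (+) (- u) ` (\<Union>z\<in>int_lattice. (\<lambda>x. x + z) ` M)"
      by (simp only: comm image_UN)
    also have "\<dots> = UNIV" using t by (simp only: translates_tile_def) (simp add: surj_plus)
    finally have cover: "(\<Union>z\<in>int_lattice. (\<lambda>x. x + z) ` ((+) (- u) ` M)) = UNIV" .
    have "interior ((\<lambda>x. x + z) ` ((+) (- u) ` M)) \<inter> interior ((\<lambda>x. x + w) ` ((+) (- u) ` M)) = {}"
      if "z \<in> int_lattice" "w \<in> int_lattice" "z \<noteq> w" for z w
    proof -
      have "interior ((\<lambda>x. x + z) ` M) \<inter> interior ((\<lambda>x. x + w) ` M) = {}"
        using t that unfolding translates_tile_def by blast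
      then show ?thesis unfolding comm int by auto
    qed
    with cover show ?thesis unfolding translates_tile_def by blast
  qed
  ultimately show ?thesis by (simp add: Zn_tile_def eq)
qed

theorem theorem6p5:
  fixes A :: "real ^ 'n ^ 'n" and D T Z :: "(real ^ 'n) set" and u :: "real ^ 'n"
  assumes "self_affine_Zn_tile A D T"
    and "ideal_tile A D T Z"
    and "u \<in> interior Z"
  shows "\<exists>F :: real ^ 'n \<Rightarrow> real ^ 'n. monotone_model A D T ((\<lambda>x. x - u) ` Z) F"
proof -
  interpret ideal_tile_setting A D T Z using assms by unfold_locales
  let ?M = "(\<lambda>x. x - u) ` Z"
  obtain E E' where E: "homeomorphism UNIV UNIV E E'" "E ` Z = Z + D"
    "\<And>x z. z \<in> int_lattice \<Longrightarrow> E (x + z) = E x + A *v z" "E u = u"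
    using exists_equivariant_homeomorphism_fixing[OF assms(3)] by blast
  define F where "F x = E (x + u) - u" for x
  have "homeomorphism UNIV UNIV F (\<lambda>y. E' (y + u) - u)"
  proof -
    have "continuous_on UNIV E" "continuous_on UNIV E'" "\<And>x. E' (E x) = x" "\<And>y. E (E' y) = y"
      using E(1) by (auto simp: homeomorphism_def)
    moreover have "continuous_on UNIV (\<lambda>x. H (x + u) - u)"
      if "continuous_on UNIV H" for H :: "real ^ 'n \<Rightarrow> real ^ 'n"
      by (intro continuous_intros continuous_on_compose2[OF that]) auto
    ultimately show ?thesis
      unfolding F_def by (intro homeomorphismI) simp_all
  qed
  moreover have "F ` ?M = ?M + D"
  proof -
    have "F ` ?M = (\<lambda>x. x - u) ` (Z + D)"
      unfolding E(2)[symmetric] by (simp add: image_image F_def)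
    also have "\<dots> = ?M + D"
      by (auto simp: set_plus_def image_iff) (metis add_diff_eq add.commute diff_add_eq)+
    finally show ?thesis .
  qed
  moreover have "Zn_equivariant (\<lambda>x. matrix_inv A *v F x)"
  proof -
    have "F (x + z) = F x + A *v z" if "z \<in> int_lattice" for x z
      using E(3)[OF that, of "x + u"] by (simp add: F_def algebra_simps)
    then show ?thesis
      by (simp add: Zn_equivariant_def matrix_vector_right_distrib inv_A_A)
  qed
  moreover have "F 0 = 0" using E(4) by (simp add: F_def)
  ultimately have "model A D ?M F"
    using Zn_tile_translated_tile[OF Zn_tile_Z] unfolding model_def by blast
  moreover have "connected (cell ?M S)" if S: "S \<subseteq> int_lattice" for S
  proof (cases "S = {} \<or> cell Z S = {}")
    case True
    then show ?thesis unfolding cell_translated_tile by (auto simp: cell_def connected_UNIV surj_def)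
  next
    case False
    then have "S \<in> tile_complex Z" using S by (simp add: tile_complex_def)
    then show ?thesis unfolding cell_translated_tile
      by (intro connected_continuous_image continuous_intros connected_cell)
  qed
  ultimately show ?thesis
    unfolding monotone_model_def using tile_complex_translated_tile[of u Z] complex_eq by blast
qed

end
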